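(* Let $\mathbf{K}$ and $\mathbf{L}$ be quasi relation algebras (with $K\cap L=\varnothing$) such that $1_{\mathbf{K}}$ is totally irreducible in $\mathbf{K}$ (and hence $\mathbf{K}$ is odd, i.e. $1_{\mathbf K}=0_{\mathbf K}$). Then their nested sum $\mathbf{K}[\mathbf{L}]$ is a quasi relation algebra.
   Context: A residuated lattice is an algebra $\langle A,\wedge,\vee,\cdot,\backslash,/,1\rangle$ such that $\langle A,\wedge,\vee\rangle$ is a lattice, $\langle A,\cdot,1\rangle$ is a monoid, and for all $a,b,c\in A$: $a\cdot b\leqslant c \iff a\leqslant c/b\iff b\leqslant a\backslash c$. An FL-algebra is a residuated lattice with an additional (arbitrary) constant $0$; its linear negations are ${\sim}a=a\backslash 0$ and $-a=0/a$. An InFL-algebra is an FL-algebra satisfying ${\sim}{-}a=a={-}{\sim}a$ for all $a$. InFL-algebras are term-equivalent to algebras $\langle A,\wedge,\vee,\cdot,{\sim},-,1,0\rangle$ with $0=-1={\sim}1$, where $\langle A,\wedge,\vee\rangle$ is a lattice, $\langle A,\cdot,1\rangle$ is a monoid and $a\cdot b\leqslant c\iff a\leqslant -(b\cdot{\sim}c)\iff b\leqslant {\sim}(-c\cdot a)$; the residuals are $c/b=-(b\cdot{\sim}c)$ and $a\backslash c={\sim}(-c\cdot a)$. Put $a+b={\sim}(-a\cdot -b)$. A quasi relation algebra (qRA) is an algebra $\langle A,\wedge,\vee,\cdot,{\sim},-,\neg,1,0\rangle$ whose $\neg$-free reduct is an InFL-algebra and which satisfies $\neg\neg a=a$, $\neg(a\vee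 b)=\neg a\wedge\neg b$, $\neg({\sim}a)=-(\neg a)$ and $\neg(a\cdot b)=\neg a+\neg b$ for all $a,b\in A$. An element $b$ of an algebra is irreducible with respect to an $n$-ary operation $f$ ($n\geqslant 1$) if $f(b_1,\dots,b_n)=b$ implies $b_i=b$ for some $i$; it is totally irreducible if it is irreducible with respect to all non-nullary operations of the algebra. Nested sum: let $\mathbf K,\mathbf L$ be qRAs with $K\cap L=\varnothing$ and $1_{\mathbf K}$ totally irreducible. The universe of $\mathbf K[\mathbf L]$ is $K[L]=(K\setminus\{1_{\mathbf K}\})\cup L$, with $1_{\mathbf K[\mathbf L]}=1_{\mathbf L}$, $0_{\mathbf K[\mathbf L]}=0_{\mathbf L}$. For $\star\in\{\cdot,\backslash,/\}$, $m_0\star_{\mathbf K[\mathbf L]}m_1$ equals: $m_0\star_{\mathbf K}m_1$ if $m_0,m_1\in K\setminus\{1_{\mathbf K}\}$; $m_0\star_{\mathbf L}m_1$ if $m_0,m_1\in L$; $m_0\star_{\mathbf K}1_{\mathbf K}$ if $m_0\in K\setminus\{1_{\mathbf K}\}$, $m_1\in L$; $1_{\mathbf K}\star_{\mathbf K}m_1$ if $m_0\in L$, $m_1\in K\setminus\{1_{\mathbf K}\}$. The operations $\wedge_{\mathbf K[\mathbf L]}$, $\vee_{\mathbf K[\mathbf L]}$ are commutative, agree with those of $\mathbf K$ on $K\setminus\{1_{\mathbf K}\}$ and with those of $\mathbf L$ on $L$, and for $k\in K\setminus\{1_{\mathbf K}\}$, $\ell\in L$: $k\wedge\ell=\ell$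 if $k\geqslant_{\mathbf K}1_{\mathbf K}$ and $k\wedge\ell=k\wedge_{\mathbf K}1_{\mathbf K}$ otherwise; $k\vee\ell=\ell$ if $k\leqslant_{\mathbf K}1_{\mathbf K}$ and $k\vee\ell=k\vee_{\mathbf K}1_{\mathbf K}$ otherwise. The linear negations are ${\sim}_{\mathbf K[\mathbf L]}m=m\backslash_{\mathbf K[\mathbf L]}0_{\mathbf K[\mathbf L]}$ and $-_{\mathbf K[\mathbf L]}m=0_{\mathbf K[\mathbf L]}/_{\mathbf K[\mathbf L]}m$. Finally $\neg_{\mathbf K[\mathbf L]}m=\neg_{\mathbf L}m$ if $m\in L$ and $\neg_{\mathbf K[\mathbf L]}m=\neg_{\mathbf K}m$ if $m\in K\setminus\{1_{\mathbf K}\}$. *)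

theory Defs
  imports "HOL-Algebra.Group"
begin

text \<open>
  Algebras are records with an explicit carrier. The \<open>\<not>\<close>-free reduct of a quasi relation algebra
  is obtained through record subtyping: \<open>inFL_algebra\<close> applies to every extension of \<open>inFL\<close>.
\<close>

record 'a inFL = "'a monoid" +
  fmeet :: "'a \<Rightarrow> 'a \<Rightarrow> 'a" (infixl \<open>\<curlywedge>\<index>\<close> 70)
  fjoin :: "'a \<Rightarrow> 'a \<Rightarrow> 'a" (infixl \<open>\<curlyvee>\<index>\<close> 65)
  fsim :: "'a \<Rightarrow> 'a" (\<open>\<^bold>\<sim>\<index> _\<close> [81] 80)
  fminus :: "'a \<Rightarrow> 'a" (\<open>\<^bold>-\<index> _\<close> [81] 80)
  fzero :: 'a (\<open>\<^bold>0\<index>\<close>)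

record 'a qra = "'a inFL" +
  qneg :: "'a \<Rightarrow> 'a" (\<open>\<^bold>\<not>\<index> _\<close> [81] 80)

definition fle :: "('a, 'm) inFL_scheme \<Rightarrow> 'a \<Rightarrow> 'a \<Rightarrow> bool" (infix \<open>\<preceq>\<index>\<close> 50)
  where "x \<preceq>\<^bsub>A\<^esub> y \<longleftrightarrow> x \<curlywedge>\<^bsub>A\<^esub> y = x"

definition lres :: "('a, 'm) inFL_scheme \<Rightarrow> 'a \<Rightarrow> 'a \<Rightarrow> 'a"  \<comment> \<open>\<open>a\c\<close>\<close>
  where "lres A a c = \<^bold>\<sim>\<^bsub>A\<^esub> (\<^bold>-\<^bsub>A\<^esub> c \<otimes>\<^bsub>A\<^esub> a)"

definition rres :: "('a, 'm) inFL_scheme \<Rightarrow> 'a \<Rightarrow> 'a \<Rightarrow> 'a"  \<comment> \<open>\<open>c/b\<close>\<close>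
  where "rres A c b = \<^bold>-\<^bsub>A\<^esub> (b \<otimes>\<^bsub>A\<^esub> \<^bold>\<sim>\<^bsub>A\<^esub> c)"

definition fplus :: "('a, 'm) inFL_scheme \<Rightarrow> 'a \<Rightarrow> 'a \<Rightarrow> 'a" (infixl \<open>\<^bold>+\<index>\<close> 65)
  where "a \<^bold>+\<^bsub>A\<^esub> b = \<^bold>\<sim>\<^bsub>A\<^esub> (\<^bold>-\<^bsub>A\<^esub> a \<otimes>\<^bsub>A\<^esub> \<^bold>-\<^bsub>A\<^esub> b)"

locale lattice_algebra =
  fixes A :: "('a, 'm) inFL_scheme" (structure)
  assumes meet_closed: "\<lbrakk>x \<in> carrier A; y \<in> carrier A\<rbrakk> \<Longrightarrow> x \<curlywedge> y \<in> carrier A"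
    and join_closed: "\<lbrakk>x \<in> carrier A; y \<in> carrier A\<rbrakk> \<Longrightarrow> x \<curlyvee> y \<in> carrier A"
    and meet_commute: "\<lbrakk>x \<in> carrier A; y \<in> carrier A\<rbrakk> \<Longrightarrow> x \<curlywedge> y = y \<curlywedge> x"
    and join_commute: "\<lbrakk>x \<in> carrier A; y \<in> carrier A\<rbrakk> \<Longrightarrow> x \<curlyvee> y = y \<curlyvee> x"
    and meet_assoc: "\<lbrakk>x \<in> carrier A; y \<in> carrier A; z \<in> carrier A\<rbrakk>
      \<Longrightarrow> (x \<curlywedge> y) \<curlywedge> z = x \<curlywedge> (y \<curlywedge> z)"
    and join_assoc: "\<lbrakk>x \<in> carrier A; y \<in> carrier A; z \<in> carrier A\<rbrakk>
      \<Longrightarrow> (x \<curlyvee> y) \<curlyvee> z = x \<curlyvee> (y \<curlyvee> z)"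
    and meet_absorb: "\<lbrakk>x \<in> carrier A; y \<in> carrier A\<rbrakk> \<Longrightarrow> x \<curlywedge> (x \<curlyvee> y) = x"
    and join_absorb: "\<lbrakk>x \<in> carrier A; y \<in> carrier A\<rbrakk> \<Longrightarrow> x \<curlyvee> (x \<curlywedge> y) = x"

locale inFL_algebra = monoid A + lattice_algebra A
  for A :: "('a, 'm) inFL_scheme" (structure) +
  assumes sim_closed: "x \<in> carrier A \<Longrightarrow> \<^bold>\<sim> x \<in> carrier A"
    and minus_closed: "x \<in> carrier A \<Longrightarrow> \<^bold>- x \<in> carrier A"
    and zero_closed: "\<^bold>0 \<in> carrier A"
    and zero_minus: "\<^bold>0 = \<^bold>- \<one>"
    and zero_sim: "\<^bold>0 = \<^bold>\<sim> \<one>"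
    and residuation_right: "\<lbrakk>a \<in> carrier A; b \<in> carrier A; c \<in> carrier A\<rbrakk>
      \<Longrightarrow> a \<otimes> b \<preceq> c \<longleftrightarrow> a \<preceq> \<^bold>- (b \<otimes> \<^bold>\<sim> c)"
    and residuation_left: "\<lbrakk>a \<in> carrier A; b \<in> carrier A; c \<in> carrier A\<rbrakk>
      \<Longrightarrow> a \<otimes> b \<preceq> c \<longleftrightarrow> b \<preceq> \<^bold>\<sim> (\<^bold>- c \<otimes> a)"

locale quasi_relation_algebra = inFL_algebra A
  for A :: "('a, 'm) qra_scheme" (structure) +
  assumes neg_closed: "x \<in> carrier A \<Longrightarrow> \<^bold>\<not> x \<in> carrier A"
    and neg_neg: "a \<in> carrier A \<Longrightarrow> \<^bold>\<not> (\<^bold>\<not> a) = a"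
    and neg_join: "\<lbrakk>a \<in> carrier A; b \<in> carrier A\<rbrakk> \<Longrightarrow> \<^bold>\<not> (a \<curlyvee> b) = \<^bold>\<not> a \<curlywedge> \<^bold>\<not> b"
    and neg_sim: "a \<in> carrier A \<Longrightarrow> \<^bold>\<not> (\<^bold>\<sim> a) = \<^bold>- (\<^bold>\<not> a)"
    and neg_mult: "\<lbrakk>a \<in> carrier A; b \<in> carrier A\<rbrakk> \<Longrightarrow> \<^bold>\<not> (a \<otimes> b) = \<^bold>\<not> a \<^bold>+ \<^bold>\<not> b"

definition irreducible_unary :: "'a set \<Rightarrow> ('a \<Rightarrow> 'a) \<Rightarrow> 'a \<Rightarrow> bool"
  where "irreducible_unary S f b \<longleftrightarrow> (\<forall>x\<in>S. f x = b \<longrightarrow> x = b)"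

definition irreducible_binary :: "'a set \<Rightarrow> ('a \<Rightarrow> 'a \<Rightarrow> 'a) \<Rightarrow> 'a \<Rightarrow> bool"
  where "irreducible_binary S f b \<longleftrightarrow> (\<forall>x\<in>S. \<forall>y\<in>S. f x y = b \<longrightarrow> x = b \<or> y = b)"

definition totally_irreducible :: "('a, 'm) qra_scheme \<Rightarrow> 'a \<Rightarrow> bool"
  where "totally_irreducible A b \<longleftrightarrow>
    irreducible_binary (carrier A) (fmeet A) b \<and>
    irreducible_binary (carrier A) (fjoin A) b \<and>
    irreducible_binary (carrier A) (mult A) b \<and>
    irreducible_unary (carrier A) (fsim A) b \<and>
    irreducible_unary (carrier A) (fminus A) b \<and>
    irreducible_unary (carrier A) (qneg A) b"

text \<open>
  In the operations of the nested sum an argument outside \<open>carrier L\<close> is understood to lie in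
  \<open>carrier K - {\<one>\<^bsub>K\<^esub>}\<close>; this is only meaningful for disjoint carriers.
\<close>

definition nested_op :: "('a, 'm) qra_scheme \<Rightarrow> ('a, 'n) qra_scheme
    \<Rightarrow> ('a \<Rightarrow> 'a \<Rightarrow> 'a) \<Rightarrow> ('a \<Rightarrow> 'a \<Rightarrow> 'a) \<Rightarrow> 'a \<Rightarrow> 'a \<Rightarrow> 'a"
  where "nested_op K L fK fL m0 m1 =
    (if m0 \<in> carrier L
     then if m1 \<in> carrier L then fL m0 m1 else fK \<one>\<^bsub>K\<^esub> m1
     else if m1 \<in> carrier L then fK m0 \<one>\<^bsub>K\<^esub> else fK m0 m1)"

definition nested_meet_mixed :: "('a, 'm) qra_scheme \<Rightarrow> 'a \<Rightarrow> 'a \<Rightarrow> 'a"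
  where "nested_meet_mixed K k l = (if \<one>\<^bsub>K\<^esub> \<preceq>\<^bsub>K\<^esub> k then l else k \<curlywedge>\<^bsub>K\<^esub> \<one>\<^bsub>K\<^esub>)"

definition nested_join_mixed :: "('a, 'm) qra_scheme \<Rightarrow> 'a \<Rightarrow> 'a \<Rightarrow> 'a"
  where "nested_join_mixed K k l = (if k \<preceq>\<^bsub>K\<^esub> \<one>\<^bsub>K\<^esub> then l else k \<curlyvee>\<^bsub>K\<^esub> \<one>\<^bsub>K\<^esub>)"

definition nested_meet :: "('a, 'm) qra_scheme \<Rightarrow> ('a, 'n) qra_scheme \<Rightarrow> 'a \<Rightarrow> 'a \<Rightarrow> 'a"
  where "nested_meet K L m0 m1 =
    (if m0 \<in> carrier L
     then if m1 \<in> carrier L then m0 \<curlywedge>\<^bsub>L\<^esub> m1 else nested_meet_mixed K m1 m0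
     else if m1 \<in> carrier L then nested_meet_mixed K m0 m1 else m0 \<curlywedge>\<^bsub>K\<^esub> m1)"

definition nested_join :: "('a, 'm) qra_scheme \<Rightarrow> ('a, 'n) qra_scheme \<Rightarrow> 'a \<Rightarrow> 'a \<Rightarrow> 'a"
  where "nested_join K L m0 m1 =
    (if m0 \<in> carrier L
     then if m1 \<in> carrier L then m0 \<curlyvee>\<^bsub>L\<^esub> m1 else nested_join_mixed K m1 m0
     else if m1 \<in> carrier L then nested_join_mixed K m0 m1 else m0 \<curlyvee>\<^bsub>K\<^esub> m1)"

definition nested_sum :: "('a, 'm) qra_scheme \<Rightarrow> ('a, 'n) qra_scheme \<Rightarrow> 'a qra"
  where "nested_sum K L =
    \<lparr>carrier = (carrier K - {\<one>\<^bsub>K\<^esub>}) \<union> carrier L,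
     mult = nested_op K L (mult K) (mult L),
     one = \<one>\<^bsub>L\<^esub>,
     fmeet = nested_meet K L,
     fjoin = nested_join K L,
     fsim = (\<lambda>m. nested_op K L (lres K) (lres L) m \<^bold>0\<^bsub>L\<^esub>),
     fminus = (\<lambda>m. nested_op K L (rres K) (rres L) \<^bold>0\<^bsub>L\<^esub> m),
     fzero = \<^bold>0\<^bsub>L\<^esub>,
     qneg = (\<lambda>m. if m \<in> carrier L then \<^bold>\<not>\<^bsub>L\<^esub> m else \<^bold>\<not>\<^bsub>K\<^esub> m)\<rparr>"

end

theory Submission
  imports Defs
begin

text \<open>
  In every InFL-algebra \<open>\<^bold>\<sim> \<^bold>0 = \<one>\<close>, so irreducibility of \<open>\<one>\<^bsub>K\<^esub>\<close> gives \<open>\<one>\<^bsub>K\<^esub> = \<^bold>0\<^bsub>K\<^esub>\<close>. Hence both linear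
  negations of \<open>K\<close> fix \<open>\<one>\<^bsub>K\<^esub>\<close>, and so does the involution \<open>\<^bold>\<not>\<close>, by irreducibility. Collapsing \<open>L\<close> to the
  single point \<open>\<one>\<^bsub>K\<^esub>\<close> is then a map \<open>K[L] \<rightarrow> K\<close> which preserves the product and all negations, which
  is injective outside \<open>L\<close>, and whose fibre over \<open>\<one>\<^bsub>K\<^esub>\<close> is \<open>L\<close>. Irreducibility says moreover that a
  term built from these operations has its value in \<open>L\<close> only if all its arguments lie in \<open>L\<close>.
  Consequently an equation between two such terms in the same variables holds in \<open>K[L]\<close> as soon as
  it holds in \<open>K\<close>, which settles arguments not all in \<open>L\<close>, and in \<open>L\<close>
  (lemma \<open>eq_if_collapse_eq\<close>).

  Meets and joins are different: the meet of some \<open>k > \<one>\<^bsub>K\<^esub>\<close> with \<open>l \<in> L\<close> is in \<open>L\<close>. For them one uses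
  the order in which \<open>L\<close> replaces the point \<open>\<one>\<^bsub>K\<^esub>\<close>: two elements of \<open>L\<close> are compared in \<open>L\<close>, all other
  pairs by their images in \<open>K\<close>. This is a partial order, the prescribed meets and joins are its
  infima and suprema (\<open>meet_glb_M\<close>, \<open>join_lub_M\<close>), and residuation, being a statement about the
  order, splits into the two cases above (\<open>residuation_M\<close>). The De Morgan law holds because \<open>\<^bold>\<not>\<close>
  exchanges the elements of \<open>K\<close> above \<open>\<one>\<^bsub>K\<^esub>\<close> with those below it (\<open>neg_join_mixed\<close>).
\<close>

section \<open>Lattices, orders, and linear negations\<close>

context lattice_algebra
begin

lemma meet_idem: "x \<in> carrier A \<Longrightarrow> x \<curlywedge> x = x"
  by (metis join_absorb meet_absorb meet_closed)

lemma le_refl: "x \<in> carrier A \<Longrightarrow> x \<preceq> x"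
  by (simp add: fle_def meet_idem)

lemma le_antisym: "\<lbrakk>x \<preceq> y; y \<preceq> x; x \<in> carrier A; y \<in> carrier A\<rbrakk> \<Longrightarrow> x = y"
  by (metis fle_def meet_commute)

lemma le_trans:
  "\<lbrakk>x \<preceq> y; y \<preceq> z; x \<in> carrier A; y \<in> carrier A; z \<in> carrier A\<rbrakk> \<Longrightarrow> x \<preceq> z"
  by (metis fle_def meet_assoc)

lemma le_iff_join: "\<lbrakk>x \<in> carrier A; y \<in> carrier A\<rbrakk> \<Longrightarrow> x \<preceq> y \<longleftrightarrow> x \<curlyvee> y = y"
  by (metis fle_def join_absorb join_commute meet_absorb meet_commute)

lemma le_meet_iff:
  assumes "x \<in> carrier A" "y \<in> carrier A" "z \<in> carrier A"
  shows "z \<preceq> x \<curlywedge> y \<longleftrightarrow> z \<preceq> x \<and> z \<preceq> y"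
  using assms by (metis fle_def meet_assoc meet_closed meet_commute meet_idem)

lemma join_le_iff:
  assumes "x \<in> carrier A" "y \<in> carrier A" "z \<in> carrier A"
  shows "x \<curlyvee> y \<preceq> z \<longleftrightarrow> x \<preceq> z \<and> y \<preceq> z"
proof
  assume "x \<curlyvee> y \<preceq> z"
  then have "(x \<curlyvee> y) \<curlyvee> z = z"
    using assms by (simp add: le_iff_join join_closed)
  moreover have "x \<preceq> x \<curlyvee> y" "y \<preceq> x \<curlyvee> y"
    using assms by (metis fle_def meet_absorb join_commute)+
  ultimately show "x \<preceq> z \<and> y \<preceq> z"
    using assms \<open>x \<curlyvee> y \<preceq> z\<close> by (meson le_trans join_closed)
next
  assume "x \<preceq> z \<and> y \<preceq> z"
  then show "x \<curlyvee> y \<preceq> z"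
    using assms by (simp add: le_iff_join join_closed join_assoc)
qed

end

text \<open>
  Every lattice law compares two elements that have the same lower bounds, or the same upper
  bounds, by the two bound conditions; antisymmetry does the rest.
\<close>

lemma lattice_algebra_if_bounds:
  fixes A :: "('a, 'm) inFL_scheme" and le :: "'a \<Rightarrow> 'a \<Rightarrow> bool"
  assumes meet_closed: "\<And>x y. \<lbrakk>x \<in> carrier A; y \<in> carrier A\<rbrakk> \<Longrightarrow> x \<curlywedge>\<^bsub>A\<^esub> y \<in> carrier A"
    and join_closed: "\<And>x y. \<lbrakk>x \<in> carrier A; y \<in> carrier A\<rbrakk> \<Longrightarrow> x \<curlyvee>\<^bsub>A\<^esub> y \<in> carrier A"
    and refl: "\<And>x. x \<in> carrier A \<Longrightarrow> le x x"
    and antisym: "\<And>x y. \<lbrakk>x \<in> carrier A; y \<in> carrier A; le x y; le y x\<rbrakk> \<Longrightarrow> x = y"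
    and trans: "\<And>x y z. \<lbrakk>x \<in> carrier A; y \<in> carrier A; z \<in> carrier A; le x y; le y z\<rbrakk> \<Longrightarrow> le x z"
    and meet_glb: "\<And>x y z. \<lbrakk>x \<in> carrier A; y \<in> carrier A; z \<in> carrier A\<rbrakk>
      \<Longrightarrow> le z (x \<curlywedge>\<^bsub>A\<^esub> y) \<longleftrightarrow> le z x \<and> le z y"
    and join_lub: "\<And>x y z. \<lbrakk>x \<in> carrier A; y \<in> carrier A; z \<in> carrier A\<rbrakk>
      \<Longrightarrow> le (x \<curlyvee>\<^bsub>A\<^esub> y) z \<longleftrightarrow> le x z \<and> le y z"
  shows "lattice_algebra A"
    and "\<lbrakk>x \<in> carrier A; y \<in> carrier A\<rbrakk> \<Longrightarrow> x \<preceq>\<^bsub>A\<^esub> y \<longleftrightarrow> le x y"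
proof -
  have lower_eqI: "u = v" if "u \<in> carrier A" "v \<in> carrier A"
    "\<And>z. z \<in> carrier A \<Longrightarrow> le z u \<longleftrightarrow> le z v" for u v
    using that antisym refl by blast
  have upper_eqI: "u = v" if "u \<in> carrier A" "v \<in> carrier A"
    "\<And>z. z \<in> carrier A \<Longrightarrow> le u z \<longleftrightarrow> le v z" for u v
    using that antisym refl by blast
  note closed = meet_closed join_closed
  show "lattice_algebra A"
  proof
    fix x y z assume in_A: "x \<in> carrier A" "y \<in> carrier A" "z \<in> carrier A"
    show "(x \<curlywedge>\<^bsub>A\<^esub> y) \<curlywedge>\<^bsub>A\<^esub> z = x \<curlywedge>\<^bsub>A\<^esub> (y \<curlywedge>\<^bsub>A\<^esub> z)"
      by (rule lower_eqI) (auto simp: in_A closed meet_glb)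
    show "(x \<curlyvee>\<^bsub>A\<^esub> y) \<curlyvee>\<^bsub>A\<^esub> z = x \<curlyvee>\<^bsub>A\<^esub> (y \<curlyvee>\<^bsub>A\<^esub> z)"
      by (rule upper_eqI) (auto simp: in_A closed join_lub)
  next
    fix x y assume in_A: "x \<in> carrier A" "y \<in> carrier A"
    show "x \<curlywedge>\<^bsub>A\<^esub> y \<in> carrier A" "x \<curlyvee>\<^bsub>A\<^esub> y \<in> carrier A"
      by (simp_all add: in_A closed)
    show "x \<curlywedge>\<^bsub>A\<^esub> y = y \<curlywedge>\<^bsub>A\<^esub> x"
      by (rule lower_eqI) (auto simp: in_A closed meet_glb)
    show "x \<curlyvee>\<^bsub>A\<^esub> y = y \<curlyvee>\<^bsub>A\<^esub> x"
      by (rule upper_eqI) (auto simp: in_A closed join_lub)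
    have "le x (x \<curlyvee>\<^bsub>A\<^esub> y)" "le (x \<curlywedge>\<^bsub>A\<^esub> y) x"
      using in_A closed refl join_lub[of x y "x \<curlyvee>\<^bsub>A\<^esub> y"] meet_glb[of x y "x \<curlywedge>\<^bsub>A\<^esub> y"]
      by blast+
    then have lower: "le z (x \<curlywedge>\<^bsub>A\<^esub> (x \<curlyvee>\<^bsub>A\<^esub> y)) \<longleftrightarrow> le z x"
      and upper: "le (x \<curlyvee>\<^bsub>A\<^esub> (x \<curlywedge>\<^bsub>A\<^esub> y)) z \<longleftrightarrow> le x z" if "z \<in> carrier A" for z
      using that in_A closed meet_glb[of x "x \<curlyvee>\<^bsub>A\<^esub> y" z] join_lub[of x "x \<curlywedge>\<^bsub>A\<^esub> y" z]
        trans[of z x "x \<curlyvee>\<^bsub>A\<^esub> y"] trans[of "x \<curlywedge>\<^bsub>A\<^esub> y" x z]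
      by blast+
    show "x \<curlywedge>\<^bsub>A\<^esub> (x \<curlyvee>\<^bsub>A\<^esub> y) = x"
      by (rule lower_eqI) (simp_all add: in_A closed lower)
    show "x \<curlyvee>\<^bsub>A\<^esub> (x \<curlywedge>\<^bsub>A\<^esub> y) = x"
      by (rule upper_eqI) (simp_all add: in_A closed upper)
  qed
  show "x \<preceq>\<^bsub>A\<^esub> y \<longleftrightarrow> le x y" if "x \<in> carrier A" "y \<in> carrier A"
    using that closed refl antisym meet_glb unfolding fle_def by metis
qed

context inFL_algebra
begin

text \<open>Both involution laws are the instances of residuation in which one factor is \<open>\<one>\<close>.\<close>

lemma minus_sim:
  assumes "c \<in> carrier A"
  shows "\<^bold>- (\<^bold>\<sim> c) = c"
proof -
  have "x \<preceq> c \<longleftrightarrow> x \<preceq> \<^bold>- (\<^bold>\<sim> c)" if "x \<in> carrier A" for x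
    using residuation_right[of x \<one> c] that assms by (simp add: sim_closed)
  then show ?thesis
    using assms by (meson le_antisym le_refl minus_closed sim_closed)
qed

lemma sim_minus:
  assumes "c \<in> carrier A"
  shows "\<^bold>\<sim> (\<^bold>- c) = c"
proof -
  have "x \<preceq> c \<longleftrightarrow> x \<preceq> \<^bold>\<sim> (\<^bold>- c)" if "x \<in> carrier A" for x
    using residuation_left[of \<one> x c] that assms by (simp add: minus_closed)
  then show ?thesis
    using assms by (meson le_antisym le_refl minus_closed sim_closed)
qed

lemma sim_zero: "\<^bold>\<sim> \<^bold>0 = \<one>"
  using sim_minus[OF one_closed] by (simp add: zero_minus)

lemma minus_zero: "\<^bold>- \<^bold>0 = \<one>"
  using minus_sim[OF one_closed] by (simp add: zero_sim)

lemma lres_zero: "a \<in> carrier A \<Longrightarrow> lres A a \<^bold>0 = \<^bold>\<sim> a"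
  by (simp add: lres_def minus_zero)

lemma rres_zero: "a \<in> carrier A \<Longrightarrow> rres A \<^bold>0 a = \<^bold>- a"
  by (simp add: rres_def sim_zero)

end

context quasi_relation_algebra
begin

lemma neg_le_iff:
  assumes "a \<in> carrier A" "b \<in> carrier A"
  shows "\<^bold>\<not> a \<preceq> \<^bold>\<not> b \<longleftrightarrow> b \<preceq> a"
proof -
  have "\<^bold>\<not> a \<preceq> \<^bold>\<not> b \<longleftrightarrow> \<^bold>\<not> (a \<curlyvee> b) = \<^bold>\<not> a"
    using assms by (simp add: fle_def neg_join)
  also have "\<dots> \<longleftrightarrow> a \<curlyvee> b = a"
    using assms neg_neg[of "a \<curlyvee> b"] neg_neg[of a] by (auto simp: join_closed)
  also have "\<dots> \<longleftrightarrow> b \<preceq> a"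
    using assms by (simp add: le_iff_join join_commute[of a b])
  finally show ?thesis .
qed

end

section \<open>Collapsing the inner algebra to a point\<close>

locale nested_pair =
  K: quasi_relation_algebra K + L: quasi_relation_algebra L
  for K :: "('a, 'm) qra_scheme" and L :: "('a, 'n) qra_scheme" +
  assumes disjoint: "carrier K \<inter> carrier L = {}"
    and irreducible: "totally_irreducible K \<one>\<^bsub>K\<^esub>"
begin

abbreviation M :: "'a qra"
  where "M \<equiv> nested_sum K L"

definition collapse :: "'a \<Rightarrow> 'a"
  where "collapse x = (if x \<in> carrier L then \<one>\<^bsub>K\<^esub> else x)"

lemma outer_odd: "\<one>\<^bsub>K\<^esub> = \<^bold>0\<^bsub>K\<^esub>"
  using irreducible K.sim_zero K.zero_closed
  by (auto simp: totally_irreducible_def irreducible_unary_def)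

lemma outer_negations_one: "\<^bold>\<sim>\<^bsub>K\<^esub> \<one>\<^bsub>K\<^esub> = \<one>\<^bsub>K\<^esub>" "\<^bold>-\<^bsub>K\<^esub> \<one>\<^bsub>K\<^esub> = \<one>\<^bsub>K\<^esub>" "\<^bold>\<not>\<^bsub>K\<^esub> \<one>\<^bsub>K\<^esub> = \<one>\<^bsub>K\<^esub>"
proof -
  show "\<^bold>\<sim>\<^bsub>K\<^esub> \<one>\<^bsub>K\<^esub> = \<one>\<^bsub>K\<^esub>" "\<^bold>-\<^bsub>K\<^esub> \<one>\<^bsub>K\<^esub> = \<one>\<^bsub>K\<^esub>"
    by (rule K.zero_sim[folded outer_odd, symmetric], rule K.zero_minus[folded outer_odd, symmetric])
  show "\<^bold>\<not>\<^bsub>K\<^esub> \<one>\<^bsub>K\<^esub> = \<one>\<^bsub>K\<^esub>"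
    using irreducible K.neg_neg[OF K.one_closed] K.neg_closed[OF K.one_closed]
    by (auto simp: totally_irreducible_def irreducible_unary_def)
qed

lemma outer_negation_eq_one_iff:
  assumes "x \<in> carrier K"
  shows "\<^bold>\<sim>\<^bsub>K\<^esub> x = \<one>\<^bsub>K\<^esub> \<longleftrightarrow> x = \<one>\<^bsub>K\<^esub>" "\<^bold>-\<^bsub>K\<^esub> x = \<one>\<^bsub>K\<^esub> \<longleftrightarrow> x = \<one>\<^bsub>K\<^esub>" "\<^bold>\<not>\<^bsub>K\<^esub> x = \<one>\<^bsub>K\<^esub> \<longleftrightarrow> x = \<one>\<^bsub>K\<^esub>"
  using assms irreducible outer_negations_one
  by (auto simp: totally_irreducible_def irreducible_unary_def)

text \<open>
  Irreducibility makes one factor equal to \<open>\<one>\<close>; since \<open>\<one>\<close> is the unit, the other factor is then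
  the product.
\<close>

lemma outer_mult_eq_one_iff:
  assumes "x \<in> carrier K" "y \<in> carrier K"
  shows "x \<otimes>\<^bsub>K\<^esub> y = \<one>\<^bsub>K\<^esub> \<longleftrightarrow> x = \<one>\<^bsub>K\<^esub> \<and> y = \<one>\<^bsub>K\<^esub>"
proof -
  have "x = \<one>\<^bsub>K\<^esub> \<or> y = \<one>\<^bsub>K\<^esub>" if "x \<otimes>\<^bsub>K\<^esub> y = \<one>\<^bsub>K\<^esub>"
    using that assms irreducible by (simp add: totally_irreducible_def irreducible_binary_def)
  then show ?thesis
    using assms by auto
qed

lemma outer_meet_join_ne_one:
  assumes "x \<in> carrier K - {\<one>\<^bsub>K\<^esub>}" "y \<in> carrier K - {\<one>\<^bsub>K\<^esub>}"
  shows "x \<curlywedge>\<^bsub>K\<^esub> y \<noteq> \<one>\<^bsub>K\<^esub>" "x \<curlyvee>\<^bsub>K\<^esub> y \<noteq> \<one>\<^bsub>K\<^esub>"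
  using assms irreducible by (auto simp: totally_irreducible_def irreducible_binary_def)

lemma carrier_M: "carrier M = (carrier K - {\<one>\<^bsub>K\<^esub>}) \<union> carrier L"
  by (simp add: nested_sum_def)

lemma one_M: "\<one>\<^bsub>M\<^esub> = \<one>\<^bsub>L\<^esub>" and zero_M: "\<^bold>0\<^bsub>M\<^esub> = \<^bold>0\<^bsub>L\<^esub>"
  by (simp_all add: nested_sum_def)

lemma outer_not_inner: "x \<in> carrier K \<Longrightarrow> x \<notin> carrier L"
  using disjoint by blast

lemma inner_in_M: "x \<in> carrier L \<Longrightarrow> x \<in> carrier M"
  by (simp add: carrier_M)

lemma collapse_closed: "x \<in> carrier M \<Longrightarrow> collapse x \<in> carrier K"
  by (auto simp: carrier_M collapse_def)

lemma collapse_inner: "x \<in> carrier L \<Longrightarrow> collapse x = \<one>\<^bsub>K\<^esub>"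
  by (simp add: collapse_def)

lemma collapse_outer: "x \<in> carrier K \<Longrightarrow> collapse x = x"
  by (simp add: collapse_def outer_not_inner)

lemma collapse_eq_one_iff: "x \<in> carrier M \<Longrightarrow> collapse x = \<one>\<^bsub>K\<^esub> \<longleftrightarrow> x \<in> carrier L"
  by (auto simp: carrier_M collapse_def)

text \<open>
  This reduces an equation in \<open>K[L]\<close> to one in \<open>K\<close> and, for values in \<open>L\<close>, to one in \<open>L\<close>: the collapse
  forgets nothing outside \<open>L\<close>.
\<close>

lemma eq_if_collapse_eq:
  assumes "x \<in> carrier M" "y \<in> carrier M" "collapse x = collapse y"
    and "\<lbrakk>x \<in> carrier L; y \<in> carrier L\<rbrakk> \<Longrightarrow> x = y"
  shows "x = y"
proof (cases "x \<in> carrier L")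
  case True
  then have "y \<in> carrier L"
    using assms collapse_eq_one_iff[of x] collapse_eq_one_iff[of y] by simp
  with True show ?thesis
    using assms(4) by blast
next
  case False
  then have "y \<notin> carrier L"
    using assms collapse_eq_one_iff[of x] collapse_eq_one_iff[of y] by simp
  with False show ?thesis
    using assms(3) by (simp add: collapse_def)
qed

subsection \<open>Products and negations\<close>

lemma mult_M:
  "x \<otimes>\<^bsub>M\<^esub> y = (if x \<in> carrier L \<and> y \<in> carrier L then x \<otimes>\<^bsub>L\<^esub> y else collapse x \<otimes>\<^bsub>K\<^esub> collapse y)"
  by (simp add: nested_sum_def nested_op_def collapse_def)

lemma neg_M: "\<^bold>\<not>\<^bsub>M\<^esub> x = (if x \<in> carrier L then \<^bold>\<not>\<^bsub>L\<^esub> x else \<^bold>\<not>\<^bsub>K\<^esub> x)"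
  by (simp add: nested_sum_def)

text \<open>
  The linear negations of \<open>K[L]\<close> are residuals into \<open>\<^bold>0\<^bsub>L\<^esub>\<close>. For an argument in \<open>K\<close> this zero stands
  for \<open>\<one>\<^bsub>K\<^esub>\<close>, which is the zero of \<open>K\<close> because \<open>K\<close> is odd.
\<close>

lemma sim_M:
  assumes "x \<in> carrier M"
  shows "\<^bold>\<sim>\<^bsub>M\<^esub> x = (if x \<in> carrier L then \<^bold>\<sim>\<^bsub>L\<^esub> x else \<^bold>\<sim>\<^bsub>K\<^esub> x)"
  using assms K.lres_zero L.lres_zero L.zero_closed
  by (auto simp: nested_sum_def nested_op_def outer_odd)

lemma minus_M:
  assumes "x \<in> carrier M"
  shows "\<^bold>-\<^bsub>M\<^esub> x = (if x \<in> carrier L then \<^bold>-\<^bsub>L\<^esub> x else \<^bold>-\<^bsub>K\<^esub> x)"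
  using assms K.rres_zero L.rres_zero L.zero_closed
  by (auto simp: nested_sum_def nested_op_def outer_odd)

lemma
  assumes "x \<in> carrier L"
  shows sim_inner: "\<^bold>\<sim>\<^bsub>M\<^esub> x = \<^bold>\<sim>\<^bsub>L\<^esub> x"
    and minus_inner: "\<^bold>-\<^bsub>M\<^esub> x = \<^bold>-\<^bsub>L\<^esub> x"
    and neg_inner: "\<^bold>\<not>\<^bsub>M\<^esub> x = \<^bold>\<not>\<^bsub>L\<^esub> x"
  using assms by (simp_all add: sim_M minus_M neg_M inner_in_M)

lemma mult_inner: "\<lbrakk>x \<in> carrier L; y \<in> carrier L\<rbrakk> \<Longrightarrow> x \<otimes>\<^bsub>M\<^esub> y = x \<otimes>\<^bsub>L\<^esub> y"
  by (simp add: mult_M)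

text \<open>
  For each operation: it stays in \<open>K[L]\<close>, it commutes with the collapse, and it takes a value in \<open>L\<close>
  only on arguments from \<open>L\<close>. Irreducibility enters in that a value in \<open>K\<close> obtained from an argument
  outside \<open>L\<close> is never the deleted point \<open>\<one>\<^bsub>K\<^esub>\<close>.
\<close>

lemma
  assumes "x \<in> carrier M" "y \<in> carrier M"
  shows mult_closed_M: "x \<otimes>\<^bsub>M\<^esub> y \<in> carrier M"
    and collapse_mult: "collapse (x \<otimes>\<^bsub>M\<^esub> y) = collapse x \<otimes>\<^bsub>K\<^esub> collapse y"
    and mult_inner_iff: "x \<otimes>\<^bsub>M\<^esub> y \<in> carrier L \<longleftrightarrow> x \<in> carrier L \<and> y \<in> carrier L"
proof -
  have "x \<otimes>\<^bsub>M\<^esub> y \<in> carrier M \<and> collapse (x \<otimes>\<^bsub>M\<^esub> y) = collapse x \<otimes>\<^bsub>K\<^esub> collapse y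
    \<and> (x \<otimes>\<^bsub>M\<^esub> y \<in> carrier L \<longleftrightarrow> x \<in> carrier L \<and> y \<in> carrier L)"
  proof (cases "x \<in> carrier L \<and> y \<in> carrier L")
    case True
    then show ?thesis
      by (simp add: mult_inner collapse_inner inner_in_M)
  next
    case False
    have in_K: "collapse x \<in> carrier K" "collapse y \<in> carrier K"
      using assms by (simp_all add: collapse_closed)
    then have "collapse x \<otimes>\<^bsub>K\<^esub> collapse y \<in> carrier K - {\<one>\<^bsub>K\<^esub>}"
      using False assms by (auto simp: outer_mult_eq_one_iff collapse_eq_one_iff)
    moreover have "x \<otimes>\<^bsub>M\<^esub> y = collapse x \<otimes>\<^bsub>K\<^esub> collapse y"
      unfolding mult_M using False by auto
    ultimately show ?thesis
      using False by (auto simp: carrier_M collapse_outer outer_not_inner)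
  qed
  then show "x \<otimes>\<^bsub>M\<^esub> y \<in> carrier M" "collapse (x \<otimes>\<^bsub>M\<^esub> y) = collapse x \<otimes>\<^bsub>K\<^esub> collapse y"
    "x \<otimes>\<^bsub>M\<^esub> y \<in> carrier L \<longleftrightarrow> x \<in> carrier L \<and> y \<in> carrier L"
    by blast+
qed

lemma
  assumes "x \<in> carrier M"
  shows sim_closed_M: "\<^bold>\<sim>\<^bsub>M\<^esub> x \<in> carrier M"
    and collapse_sim: "collapse (\<^bold>\<sim>\<^bsub>M\<^esub> x) = \<^bold>\<sim>\<^bsub>K\<^esub> (collapse x)"
    and sim_inner_iff: "\<^bold>\<sim>\<^bsub>M\<^esub> x \<in> carrier L \<longleftrightarrow> x \<in> carrier L"
  using assms
  by (cases "x \<in> carrier L"; simp add: sim_M carrier_M K.sim_closed L.sim_closed collapse_inner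
      collapse_outer outer_not_inner outer_negation_eq_one_iff outer_negations_one)+

lemma
  assumes "x \<in> carrier M"
  shows minus_closed_M: "\<^bold>-\<^bsub>M\<^esub> x \<in> carrier M"
    and collapse_minus: "collapse (\<^bold>-\<^bsub>M\<^esub> x) = \<^bold>-\<^bsub>K\<^esub> (collapse x)"
    and minus_inner_iff: "\<^bold>-\<^bsub>M\<^esub> x \<in> carrier L \<longleftrightarrow> x \<in> carrier L"
  using assms
  by (cases "x \<in> carrier L"; simp add: minus_M carrier_M K.minus_closed L.minus_closed collapse_inner
      collapse_outer outer_not_inner outer_negation_eq_one_iff outer_negations_one)+

lemma
  assumes "x \<in> carrier M"
  shows neg_closed_M: "\<^bold>\<not>\<^bsub>M\<^esub> x \<in> carrier M"
    and collapse_neg: "collapse (\<^bold>\<not>\<^bsub>M\<^esub> x) = \<^bold>\<not>\<^bsub>K\<^esub> (collapse x)"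
    and neg_inner_iff: "\<^bold>\<not>\<^bsub>M\<^esub> x \<in> carrier L \<longleftrightarrow> x \<in> carrier L"
  using assms
  by (cases "x \<in> carrier L"; simp add: neg_M carrier_M K.neg_closed L.neg_closed collapse_inner
      collapse_outer outer_not_inner outer_negation_eq_one_iff outer_negations_one)+

lemmas closed_M = mult_closed_M sim_closed_M minus_closed_M neg_closed_M
lemmas collapse_ops = collapse_mult collapse_sim collapse_minus collapse_neg
lemmas ops_inner_iff = mult_inner_iff sim_inner_iff minus_inner_iff neg_inner_iff
lemmas ops_inner = mult_inner sim_inner minus_inner neg_inner

lemma monoid_M: "monoid M"
proof (rule monoidI)
  fix x y z assume in_M: "x \<in> carrier M" "y \<in> carrier M" "z \<in> carrier M"
  show "x \<otimes>\<^bsub>M\<^esub> y \<otimes>\<^bsub>M\<^esub> z = x \<otimes>\<^bsub>M\<^esub> (y \<otimes>\<^bsub>M\<^esub> z)"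
    by (rule eq_if_collapse_eq)
      (simp_all add: in_M closed_M collapse_ops ops_inner_iff ops_inner collapse_closed
        K.m_assoc L.m_assoc)
next
  fix x assume in_M: "x \<in> carrier M"
  show "\<one>\<^bsub>M\<^esub> \<otimes>\<^bsub>M\<^esub> x = x" "x \<otimes>\<^bsub>M\<^esub> \<one>\<^bsub>M\<^esub> = x"
    unfolding one_M
    by (rule eq_if_collapse_eq;
        simp add: in_M closed_M collapse_ops ops_inner collapse_closed collapse_inner inner_in_M)+
qed (simp_all add: closed_M one_M inner_in_M)

subsection \<open>The order that puts the inner algebra in place of the unit\<close>

definition nested_le :: "'a \<Rightarrow> 'a \<Rightarrow> bool"
  where "nested_le x y \<longleftrightarrow>
    (if x \<in> carrier L \<and> y \<in> carrier L then x \<preceq>\<^bsub>L\<^esub> y else collapse x \<preceq>\<^bsub>K\<^esub> collapse y)"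

lemma nested_le_inner: "\<lbrakk>x \<in> carrier L; y \<in> carrier L\<rbrakk> \<Longrightarrow> nested_le x y \<longleftrightarrow> x \<preceq>\<^bsub>L\<^esub> y"
  by (simp add: nested_le_def)

lemma nested_le_outer:
  "\<not> (x \<in> carrier L \<and> y \<in> carrier L) \<Longrightarrow> nested_le x y \<longleftrightarrow> collapse x \<preceq>\<^bsub>K\<^esub> collapse y"
  by (auto simp: nested_le_def)

lemma collapse_mono: "nested_le x y \<Longrightarrow> collapse x \<preceq>\<^bsub>K\<^esub> collapse y"
  by (auto simp: nested_le_def collapse_inner K.le_refl split: if_splits)

lemma nested_le_refl: "x \<in> carrier M \<Longrightarrow> nested_le x x"
  by (simp add: nested_le_def L.le_refl K.le_refl collapse_closed)

lemma nested_le_antisym: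
  assumes "x \<in> carrier M" "y \<in> carrier M" "nested_le x y" "nested_le y x"
  shows "x = y"
proof (rule eq_if_collapse_eq)
  show "collapse x = collapse y"
    using assms by (blast intro: K.le_antisym collapse_mono collapse_closed)
  show "x = y" if "x \<in> carrier L" "y \<in> carrier L"
    using that assms by (auto simp: nested_le_inner intro: L.le_antisym)
qed (use assms in auto)

text \<open>
  The delicate case is \<open>x, z \<in> L\<close>: then \<open>y\<close> collapses to an element between \<open>\<one>\<^bsub>K\<^esub>\<close> and \<open>\<one>\<^bsub>K\<^esub>\<close>, so it is
  in \<open>L\<close> as well.
\<close>

lemma nested_le_trans:
  assumes in_M: "x \<in> carrier M" "y \<in> carrier M" "z \<in> carrier M"
    and le: "nested_le x y" "nested_le y z"
  shows "nested_le x z"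
proof (cases "x \<in> carrier L \<and> z \<in> carrier L")
  case True
  then have "\<one>\<^bsub>K\<^esub> \<preceq>\<^bsub>K\<^esub> collapse y" "collapse y \<preceq>\<^bsub>K\<^esub> \<one>\<^bsub>K\<^esub>"
    using le[THEN collapse_mono] by (simp_all add: collapse_inner)
  then have "y \<in> carrier L"
    using in_M by (metis K.le_antisym K.one_closed collapse_closed collapse_eq_one_iff)
  then show ?thesis
    using True le by (auto simp: nested_le_inner intro: L.le_trans)
next
  case False
  then show ?thesis
    using in_M le[THEN collapse_mono] by (auto simp: nested_le_outer collapse_closed intro: K.le_trans)
qed

lemma meet_M: "x \<curlywedge>\<^bsub>M\<^esub> y = nested_meet K L x y" and join_M: "x \<curlyvee>\<^bsub>M\<^esub> y = nested_join K L x y"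
  by (simp_all add: nested_sum_def)

lemma meet_mixed_closed:
  assumes "k \<in> carrier K - {\<one>\<^bsub>K\<^esub>}" "l \<in> carrier L"
  shows "nested_meet_mixed K k l \<in> carrier M"
proof (cases "\<one>\<^bsub>K\<^esub> \<preceq>\<^bsub>K\<^esub> k")
  case False
  then have "k \<curlywedge>\<^bsub>K\<^esub> \<one>\<^bsub>K\<^esub> \<noteq> \<one>\<^bsub>K\<^esub>"
    using assms by (auto simp: fle_def K.meet_commute)
  then show ?thesis
    using False assms by (simp add: nested_meet_mixed_def carrier_M K.meet_closed)
qed (simp add: nested_meet_mixed_def inner_in_M assms)

lemma join_mixed_closed:
  assumes "k \<in> carrier K - {\<one>\<^bsub>K\<^esub>}" "l \<in> carrier L"
  shows "nested_join_mixed K k l \<in> carrier M"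
proof (cases "k \<preceq>\<^bsub>K\<^esub> \<one>\<^bsub>K\<^esub>")
  case False
  then have "k \<curlyvee>\<^bsub>K\<^esub> \<one>\<^bsub>K\<^esub> \<noteq> \<one>\<^bsub>K\<^esub>"
    using assms by (auto simp: K.le_iff_join)
  then show ?thesis
    using False assms by (simp add: nested_join_mixed_def carrier_M K.join_closed)
qed (simp add: nested_join_mixed_def inner_in_M assms)

text \<open>
  If \<open>k \<ge> \<one>\<^bsub>K\<^esub>\<close>, then \<open>k\<close> lies above all of \<open>L\<close> and \<open>l\<close> is the infimum. Otherwise no element of \<open>L\<close> is
  below \<open>k\<close>, so common lower bounds are outside \<open>L\<close> and only see \<open>l\<close> as \<open>\<one>\<^bsub>K\<^esub>\<close>.
\<close>

lemma meet_mixed_glb: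
  assumes k: "k \<in> carrier K - {\<one>\<^bsub>K\<^esub>}" and l: "l \<in> carrier L" and z: "z \<in> carrier M"
  shows "nested_le z (nested_meet_mixed K k l) \<longleftrightarrow> nested_le z k \<and> nested_le z l"
proof (cases "\<one>\<^bsub>K\<^esub> \<preceq>\<^bsub>K\<^esub> k")
  case True
  have "nested_le l k"
    using True k l by (simp add: nested_le_outer outer_not_inner collapse_inner collapse_outer)
  then show ?thesis
    using True k l z nested_le_trans[of z l k]
    by (auto simp: nested_meet_mixed_def inner_in_M carrier_M)
next
  case False
  have "nested_le z (k \<curlywedge>\<^bsub>K\<^esub> \<one>\<^bsub>K\<^esub>) \<longleftrightarrow> collapse z \<preceq>\<^bsub>K\<^esub> k \<and> collapse z \<preceq>\<^bsub>K\<^esub> \<one>\<^bsub>K\<^esub>"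
    using k z by (simp add: nested_le_outer outer_not_inner collapse_outer K.meet_closed
        K.le_meet_iff collapse_closed)
  moreover have "nested_le z k \<longleftrightarrow> collapse z \<preceq>\<^bsub>K\<^esub> k"
    using k by (simp add: nested_le_outer outer_not_inner collapse_outer)
  moreover have "nested_le z l \<longleftrightarrow> collapse z \<preceq>\<^bsub>K\<^esub> \<one>\<^bsub>K\<^esub>" if "collapse z \<preceq>\<^bsub>K\<^esub> k"
  proof -
    have "z \<notin> carrier L"
      using that False by (auto simp: collapse_inner)
    then show ?thesis
      using l by (simp add: nested_le_outer collapse_inner)
  qed
  ultimately show ?thesis
    using False by (auto simp: nested_meet_mixed_def)
qed

lemma join_mixed_lub:
  assumes k: "k \<in> carrier K - {\<one>\<^bsub>K\<^esub>}" and l: "l \<in> carrier L" and z: "z \<in> carrier M"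
  shows "nested_le (nested_join_mixed K k l) z \<longleftrightarrow> nested_le k z \<and> nested_le l z"
proof (cases "k \<preceq>\<^bsub>K\<^esub> \<one>\<^bsub>K\<^esub>")
  case True
  have "nested_le k l"
    using True k l by (simp add: nested_le_outer outer_not_inner collapse_inner collapse_outer)
  then show ?thesis
    using True k l z nested_le_trans[of k l z]
    by (auto simp: nested_join_mixed_def inner_in_M carrier_M)
next
  case False
  have "nested_le (k \<curlyvee>\<^bsub>K\<^esub> \<one>\<^bsub>K\<^esub>) z \<longleftrightarrow> k \<preceq>\<^bsub>K\<^esub> collapse z \<and> \<one>\<^bsub>K\<^esub> \<preceq>\<^bsub>K\<^esub> collapse z"
    using k z by (simp add: nested_le_outer outer_not_inner collapse_outer K.join_closed
        K.join_le_iff collapse_closed)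
  moreover have "nested_le k z \<longleftrightarrow> k \<preceq>\<^bsub>K\<^esub> collapse z"
    using k by (simp add: nested_le_outer outer_not_inner collapse_outer)
  moreover have "nested_le l z \<longleftrightarrow> \<one>\<^bsub>K\<^esub> \<preceq>\<^bsub>K\<^esub> collapse z" if "k \<preceq>\<^bsub>K\<^esub> collapse z"
  proof -
    have "z \<notin> carrier L"
      using that False by (auto simp: collapse_inner)
    then show ?thesis
      using l by (simp add: nested_le_outer collapse_inner)
  qed
  ultimately show ?thesis
    using False by (auto simp: nested_join_mixed_def)
qed

lemma
  assumes "x \<in> carrier M" "y \<in> carrier M"
  shows meet_closed_M: "x \<curlywedge>\<^bsub>M\<^esub> y \<in> carrier M" and join_closed_M: "x \<curlyvee>\<^bsub>M\<^esub> y \<in> carrier M"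
  using assms outer_meet_join_ne_one[of x y] meet_mixed_closed join_mixed_closed
  by (auto simp: meet_M join_M nested_meet_def nested_join_def carrier_M
      K.meet_closed K.join_closed L.meet_closed L.join_closed)

text \<open>
  For two elements of \<open>L\<close>, a bound outside \<open>L\<close> only has to be compared with \<open>\<one>\<^bsub>K\<^esub>\<close>, the common image
  of both elements and of their meet or join.
\<close>

lemma meet_glb_M:
  assumes x: "x \<in> carrier M" and y: "y \<in> carrier M" and z: "z \<in> carrier M"
  shows "nested_le z (x \<curlywedge>\<^bsub>M\<^esub> y) \<longleftrightarrow> nested_le z x \<and> nested_le z y"
proof (cases "x \<in> carrier L"; cases "y \<in> carrier L")
  assume "x \<in> carrier L" "y \<in> carrier L"
  then show ?thesis
    by (cases "z \<in> carrier L")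
      (simp_all add: meet_M nested_meet_def nested_le_def collapse_inner L.meet_closed L.le_meet_iff)
next
  assume "x \<in> carrier L" "y \<notin> carrier L"
  then show ?thesis
    using y z meet_mixed_glb[of y x z] by (auto simp: meet_M nested_meet_def carrier_M)
next
  assume "x \<notin> carrier L" "y \<in> carrier L"
  then show ?thesis
    using x z meet_mixed_glb[of x y z] by (auto simp: meet_M nested_meet_def carrier_M)
next
  assume "x \<notin> carrier L" "y \<notin> carrier L"
  then show ?thesis
    using x y collapse_closed[OF z]
    by (simp add: meet_M nested_meet_def carrier_M nested_le_outer outer_not_inner collapse_outer
        K.meet_closed K.le_meet_iff)
qed

lemma join_lub_M:
  assumes x: "x \<in> carrier M" and y: "y \<in> carrier M" and z: "z \<in> carrier M"
  shows "nested_le (x \<curlyvee>\<^bsub>M\<^esub> y) z \<longleftrightarrow> nested_le x z \<and> nested_le y z"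
proof (cases "x \<in> carrier L"; cases "y \<in> carrier L")
  assume "x \<in> carrier L" "y \<in> carrier L"
  then show ?thesis
    by (cases "z \<in> carrier L")
      (simp_all add: join_M nested_join_def nested_le_def collapse_inner L.join_closed L.join_le_iff)
next
  assume "x \<in> carrier L" "y \<notin> carrier L"
  then show ?thesis
    using y z join_mixed_lub[of y x z] by (auto simp: join_M nested_join_def carrier_M)
next
  assume "x \<notin> carrier L" "y \<in> carrier L"
  then show ?thesis
    using x z join_mixed_lub[of x y z] by (auto simp: join_M nested_join_def carrier_M)
next
  assume "x \<notin> carrier L" "y \<notin> carrier L"
  then show ?thesis
    using x y collapse_closed[OF z]
    by (simp add: join_M nested_join_def carrier_M nested_le_outer outer_not_inner collapse_outer
        K.join_closed K.join_le_iff)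
qed

lemmas nested_le_bounds =
  meet_closed_M join_closed_M nested_le_refl nested_le_antisym nested_le_trans meet_glb_M join_lub_M

lemma lattice_M: "lattice_algebra M"
  by (rule lattice_algebra_if_bounds(1)[OF nested_le_bounds])

lemma fle_M: "\<lbrakk>x \<in> carrier M; y \<in> carrier M\<rbrakk> \<Longrightarrow> x \<preceq>\<^bsub>M\<^esub> y \<longleftrightarrow> nested_le x y"
  by (rule lattice_algebra_if_bounds(2)[OF nested_le_bounds])

section \<open>The nested sum is a quasi relation algebra\<close>

text \<open>
  If one of \<open>a\<close>, \<open>b\<close>, \<open>c\<close> is outside \<open>L\<close>, then each inequality has a side outside \<open>L\<close>, so all of
  them are read off in \<open>K\<close>.
\<close>

lemma residuation_M:
  assumes "a \<in> carrier M" "b \<in> carrier M" "c \<in> carrier M"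
  shows "a \<otimes>\<^bsub>M\<^esub> b \<preceq>\<^bsub>M\<^esub> c \<longleftrightarrow> a \<preceq>\<^bsub>M\<^esub> \<^bold>-\<^bsub>M\<^esub> (b \<otimes>\<^bsub>M\<^esub> \<^bold>\<sim>\<^bsub>M\<^esub> c)"
    and "a \<otimes>\<^bsub>M\<^esub> b \<preceq>\<^bsub>M\<^esub> c \<longleftrightarrow> b \<preceq>\<^bsub>M\<^esub> \<^bold>\<sim>\<^bsub>M\<^esub> (\<^bold>-\<^bsub>M\<^esub> c \<otimes>\<^bsub>M\<^esub> a)"
proof -
  have "(a \<otimes>\<^bsub>M\<^esub> b \<preceq>\<^bsub>M\<^esub> c \<longleftrightarrow> a \<preceq>\<^bsub>M\<^esub> \<^bold>-\<^bsub>M\<^esub> (b \<otimes>\<^bsub>M\<^esub> \<^bold>\<sim>\<^bsub>M\<^esub> c)) \<and>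
    (a \<otimes>\<^bsub>M\<^esub> b \<preceq>\<^bsub>M\<^esub> c \<longleftrightarrow> b \<preceq>\<^bsub>M\<^esub> \<^bold>\<sim>\<^bsub>M\<^esub> (\<^bold>-\<^bsub>M\<^esub> c \<otimes>\<^bsub>M\<^esub> a))"
  proof (cases "a \<in> carrier L \<and> b \<in> carrier L \<and> c \<in> carrier L")
    case True
    then show ?thesis
      using assms L.residuation_right[of a b c] L.residuation_left[of a b c]
      by (simp add: fle_M nested_le_inner ops_inner inner_in_M L.sim_closed L.minus_closed)
  next
    case False
    then show ?thesis
      using assms K.residuation_right[of "collapse a" "collapse b" "collapse c"]
        K.residuation_left[of "collapse a" "collapse b" "collapse c"]
      by (auto simp add: fle_M closed_M nested_le_outer ops_inner_iff collapse_ops collapse_closed)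
  qed
  then show "a \<otimes>\<^bsub>M\<^esub> b \<preceq>\<^bsub>M\<^esub> c \<longleftrightarrow> a \<preceq>\<^bsub>M\<^esub> \<^bold>-\<^bsub>M\<^esub> (b \<otimes>\<^bsub>M\<^esub> \<^bold>\<sim>\<^bsub>M\<^esub> c)"
    "a \<otimes>\<^bsub>M\<^esub> b \<preceq>\<^bsub>M\<^esub> c \<longleftrightarrow> b \<preceq>\<^bsub>M\<^esub> \<^bold>\<sim>\<^bsub>M\<^esub> (\<^bold>-\<^bsub>M\<^esub> c \<otimes>\<^bsub>M\<^esub> a)"
    by blast+
qed

lemma inFL_M: "inFL_algebra M"
proof -
  interpret monoid M by (rule monoid_M)
  interpret lattice_algebra M by (rule lattice_M)
  show ?thesis
    by unfold_locales
      (simp_all add: closed_M residuation_M[symmetric] zero_M one_M inner_in_M sim_inner minus_inner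
        L.zero_closed flip: L.zero_sim L.zero_minus)
qed

text \<open>
  Since \<open>\<^bold>\<not>\<close> fixes \<open>\<one>\<^bsub>K\<^esub>\<close> and reverses the order of \<open>K\<close>, it exchanges the case conditions of mixed joins
  and mixed meets.
\<close>

lemma neg_join_mixed:
  assumes "k \<in> carrier K - {\<one>\<^bsub>K\<^esub>}" "l \<in> carrier L"
  shows "\<^bold>\<not>\<^bsub>M\<^esub> (nested_join_mixed K k l) = nested_meet_mixed K (\<^bold>\<not>\<^bsub>K\<^esub> k) (\<^bold>\<not>\<^bsub>L\<^esub> l)"
proof -
  have "\<one>\<^bsub>K\<^esub> \<preceq>\<^bsub>K\<^esub> \<^bold>\<not>\<^bsub>K\<^esub> k \<longleftrightarrow> k \<preceq>\<^bsub>K\<^esub> \<one>\<^bsub>K\<^esub>"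
    using assms K.neg_le_iff[of "\<one>\<^bsub>K\<^esub>" k] by (simp add: outer_negations_one)
  then show ?thesis
    using assms by (simp add: nested_join_mixed_def nested_meet_mixed_def neg_M outer_not_inner
        K.join_closed K.neg_join outer_negations_one)
qed

lemma neg_join_M:
  assumes "a \<in> carrier M" "b \<in> carrier M"
  shows "\<^bold>\<not>\<^bsub>M\<^esub> (a \<curlyvee>\<^bsub>M\<^esub> b) = \<^bold>\<not>\<^bsub>M\<^esub> a \<curlywedge>\<^bsub>M\<^esub> \<^bold>\<not>\<^bsub>M\<^esub> b"
  using assms neg_join_mixed[of a b] neg_join_mixed[of b a]
  by (auto simp: join_M meet_M nested_join_def nested_meet_def neg_M carrier_M outer_not_inner
      K.neg_closed L.neg_closed K.join_closed L.join_closed K.neg_join L.neg_join)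

lemma quasi_relation_algebra_M: "quasi_relation_algebra M"
proof -
  interpret inFL_algebra M by (rule inFL_M)
  show ?thesis
  proof
    fix a b assume in_M: "a \<in> carrier M" "b \<in> carrier M"
    show "\<^bold>\<not>\<^bsub>M\<^esub> (a \<otimes>\<^bsub>M\<^esub> b) = \<^bold>\<not>\<^bsub>M\<^esub> a \<^bold>+\<^bsub>M\<^esub> \<^bold>\<not>\<^bsub>M\<^esub> b"
      unfolding fplus_def
      by (rule eq_if_collapse_eq)
        (simp_all add: in_M closed_M collapse_ops ops_inner_iff ops_inner collapse_closed
          L.neg_closed L.minus_closed K.neg_mult L.neg_mult fplus_def)
  next
    fix a assume in_M: "a \<in> carrier M"
    show "\<^bold>\<not>\<^bsub>M\<^esub> (\<^bold>\<sim>\<^bsub>M\<^esub> a) = \<^bold>-\<^bsub>M\<^esub> (\<^bold>\<not>\<^bsub>M\<^esub> a)" "\<^bold>\<not>\<^bsub>M\<^esub> (\<^bold>\<not>\<^bsub>M\<^esub> a) = a"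
      by (rule eq_if_collapse_eq;
          simp add: in_M closed_M collapse_ops ops_inner_iff ops_inner collapse_closed
            L.neg_closed L.sim_closed K.neg_sim L.neg_sim K.neg_neg L.neg_neg)+
  qed (simp_all add: closed_M neg_join_M)
qed

end

theorem proposition2p8:
  fixes K :: "('a, 'm) qra_scheme" and L :: "('a, 'n) qra_scheme"
  assumes "quasi_relation_algebra K"
    and "quasi_relation_algebra L"
    and "carrier K \<inter> carrier L = {}"
    and "totally_irreducible K \<one>\<^bsub>K\<^esub>"
  shows "\<one>\<^bsub>K\<^esub> = \<^bold>0\<^bsub>K\<^esub> \<and> quasi_relation_algebra (nested_sum K L)"
proof -
  interpret nested_pair K L
    using assms by (intro nested_pair.intro nested_pair_axioms.intro)
  show ?thesis
    using outer_odd quasi_relation_algebra_M by blast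
qed

end
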